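(* Let $\mathcal{A}$ be a finite alphabet with $|\mathcal{A}|\ge 4$. Then Ann has a winning strategy in the nonrepetitive game over $\mathcal{A}$: she has a strategy such that, whatever letters Ben plays, the shared word never contains a square of period at least $2$ as a factor, so the game continues forever.
   Context: A square is a word of the form $uu$ with $u$ a non-empty word; its period is $|u|$. The nonrepetitive game over an alphabet $\mathcal{A}$ is played by Ann and Ben, who, starting from the empty word, alternately append one letter of $\mathcal{A}$ to the end of a shared word, Ann playing first. Ben wins as soon as the shared word contains a factor that is a square of period at least $2$ (squares of period $1$, i.e. $aa$, are allowed). Ann wins if this never happens, i.e. if she can build arbitrarily long words. *)

theory Defs
  imports Main "HOL-Library.Sublist"
begin

definition square_of_period :: "nat \<Rightarrow> 'a list \<Rightarrow> bool" where
  "square_of_period p w \<longleftrightarrow> (\<exists>u. u \<noteq> [] \<and> length u = p \<and> w = u @ u)"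

definition has_long_square :: "'a list \<Rightarrow> bool" where
  "has_long_square w \<longleftrightarrow> (\<exists>s p. sublist s w \<and> square_of_period p s \<and> p \<ge> 2)"

(* Ann's strategy sigma maps the current word to her next letter. Ben's letters are given as a
   sequence b: quantifying over all b covers adaptive play by Ben, since sigma is deterministic.
   The word after n letters; Ann plays the letters at even positions, counted from 0. *)
primrec play :: "('a list \<Rightarrow> 'a) \<Rightarrow> (nat \<Rightarrow> 'a) \<Rightarrow> nat \<Rightarrow> 'a list" where
  "play \<sigma> b 0 = []"
| "play \<sigma> b (Suc n) = play \<sigma> b n @ [if even n then \<sigma> (play \<sigma> b n) else b (n div 2)]"

definition ann_strategy :: "'a set \<Rightarrow> ('a list \<Rightarrow> 'a) \<Rightarrow> bool" where
  "ann_strategy A \<sigma> \<longleftrightarrow> (\<forall>w \<in> lists A. \<sigma> w \<in> A)"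

definition ann_winning_strategy :: "'a set \<Rightarrow> ('a list \<Rightarrow> 'a) \<Rightarrow> bool" where
  "ann_winning_strategy A \<sigma> \<longleftrightarrow>
     ann_strategy A \<sigma> \<and>
     (\<forall>b. (\<forall>i. b i \<in> A) \<longrightarrow> (\<forall>n. \<not> has_long_square (play \<sigma> b n)))"

end

theory Submission
  imports Defs Complex_Main "HOL-Combinatorics.Transposition"
begin

text \<open>
  Ann has four letters and keeps a potential below a value. The value of a word depends on its last eight
  letters and measures how many continuations Ann has, whatever Ben plays, when only squares of period at most 5
  are forbidden; their number grows by a factor larger than 3/2 per move of Ann.
  A period \<open>p \<ge> 6\<close> is dangerous when a suffix of the word repeats what happened \<open>p\<close>
  places earlier. It carries a weight growing by the factor 3/2 plus a small charge at every move of Ann that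
  prolongs the repetition and reaching 1 at the completion of a square. Every dangerous period predicts just
  one letter, so the weights are shared among Ann's possible moves, and after a move the dangerous periods have
  large gaps (two of them close to each other would reveal a short repetition), which bounds the sum of the
  charges. Averaging over Ann's moves, one of them keeps the potential below the value whatever Ben replies. The
  remaining inequality involves only the last eight letters and is checked by evaluation.
\<close>

section \<open>Histories and blocked letters\<close>

text \<open>A history is the word read backwards, so that its head is the latest letter. With Ann to move,
  Ben's letters sit at the even and Ann's at the odd positions of the history. The value of
  \<open>match_len r p\<close> is the length of the longest suffix of the word that also occurs
  \<open>p\<close> places earlier; a square of period \<open>p\<close> is complete once it reaches \<open>p\<close>.\<close>

definition match_len :: "'a list \<Rightarrow> nat \<Rightarrow> nat" where
  "match_len r p = length (takeWhile (\<lambda>(x, y). x = y) (zip r (drop p r)))"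

lemma match_len_Cons:
  assumes "p > 0"
  shows "match_len (x # r) p = (if p \<le> length r \<and> r ! (p - 1) = x then Suc (match_len r p) else 0)"
proof (cases "p \<le> length r")
  case True
  with assms have "drop p (x # r) = r ! (p - 1) # drop p r"
    by (cases p) (auto simp: Cons_nth_drop_Suc)
  with True show ?thesis by (auto simp: match_len_def)
qed (use assms in \<open>simp add: match_len_def\<close>)

lemma match_len_ge_iff:
  "l \<le> match_len r p \<longleftrightarrow> l = 0 \<or> l + p \<le> length r \<and> (\<forall>i<l. r ! i = r ! (i + p))"
proof (cases "l = 0")
  case False
  define zs where "zs = zip r (drop p r)"
  define P :: "'a \<times> 'a \<Rightarrow> bool" where "P = (\<lambda>(x, y). x = y)"
  have len: "length zs = length r - p" by (simp add: zs_def)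
  have nth: "P (zs ! i) \<longleftrightarrow> r ! i = r ! (i + p)" if "i + p < length r" for i
    using that by (simp add: zs_def P_def add.commute)
  have "l \<le> length (takeWhile P zs) \<longleftrightarrow> l \<le> length zs \<and> (\<forall>i<l. P (zs ! i))"
  proof
    assume l: "l \<le> length (takeWhile P zs)"
    have "P (zs ! i)" if "i < l" for i
      using that l by (metis nth_mem order_less_le_trans set_takeWhileD takeWhile_nth)
    with l show "l \<le> length zs \<and> (\<forall>i<l. P (zs ! i))"
      using length_takeWhile_le order_trans by blast
  next
    assume "l \<le> length zs \<and> (\<forall>i<l. P (zs ! i))"
    then show "l \<le> length (takeWhile P zs)"
      by (metis length_takeWhile_less_P_nth)
  qed
  moreover have "(l \<le> length zs \<and> (\<forall>i<l. P (zs ! i))) \<longleftrightarrow>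
      l + p \<le> length r \<and> (\<forall>i<l. r ! i = r ! (i + p))"
    using False len nth by auto
  ultimately show ?thesis
    using False by (simp add: match_len_def zs_def P_def)
qed simp

lemma match_len_nth:
  assumes "i < match_len r p"
  shows "i + p < length r" "r ! i = r ! (i + p)"
  using assms match_len_ge_iff[of "Suc i" r p] by (auto simp: Suc_le_eq)

lemma match_len_Cons_Cons:
  assumes "2 \<le> match_len (b # a # r) p" "2 \<le> p"
  shows "p \<le> length r" "r ! (p - 1) = a" "r ! (p - 2) = b"
    "match_len (b # a # r) p = match_len r p + 2"
proof -
  have "p \<le> length r \<and> r ! (p - 1) = a \<and> r ! (p - 2) = b
      \<and> match_len (b # a # r) p = match_len r p + 2"
    using assms by (auto simp: match_len_Cons nth_Cons' split: if_splits)
      (auto simp: numeral_2_eq_2)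
  then show "p \<le> length r" "r ! (p - 1) = a" "r ! (p - 2) = b"
    "match_len (b # a # r) p = match_len r p + 2" by auto
qed

text \<open>Playing a blocked letter would complete a square of period 2 to 5, or let Ben do so.\<close>

definition blocked :: "'a list \<Rightarrow> 'a \<Rightarrow> bool" where
  "blocked r a \<longleftrightarrow> (\<exists>p\<in>{2..5}. p \<le> length r \<and> p \<le> match_len r p + 2 \<and> r ! (p - 1) = a)"

definition legal :: "'a list \<Rightarrow> bool" where
  "legal r \<longleftrightarrow> (\<forall>i<length r. odd i \<longrightarrow> \<not> blocked (drop (Suc i) r) (r ! i))"

lemma legal_Cons_Cons: "legal (b # a # r) \<longleftrightarrow> \<not> blocked r a \<and> legal r"
  by (simp add: legal_def All_less_Suc2)

text \<open>Just before Ann played \<open>t ! j\<close>, the other \<open>k - 2\<close> letters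
  already formed a match with period \<open>k\<close>; her letter prolonged it and hence was
  blocked.\<close>

lemma legal_no_repetition:
  assumes "legal t" "odd j" "2 \<le> k" "k \<le> 5"
    and m: "\<And>i. i < k - 1 \<Longrightarrow> j + i + k < length t \<and> t ! (j + i) = t ! (j + i + k)"
  shows False
proof -
  have len: "j + (k - 2) + k < length t" using m[of "k - 2"] assms(3) by simp
  have "k - 2 \<le> match_len (drop (Suc j) t) k"
    unfolding match_len_ge_iff using len m[of "Suc _"] assms(3) by (auto simp: algebra_simps)
  moreover have "drop (Suc j) t ! (k - 1) = t ! j"
    using m[of 0] assms(3) len by (simp add: Suc_le_eq)
  ultimately have "blocked (drop (Suc j) t) (t ! j)"
    unfolding blocked_def using assms(3,4) len by (intro bexI[of _ k]) auto
  then show False using assms(1,2) len by (auto simp: legal_def)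
qed

definition square_free_hist :: "'a list \<Rightarrow> bool" where
  "square_free_hist r \<longleftrightarrow> (\<forall>i p. 2 \<le> p \<longrightarrow> match_len (drop i r) p < p)"

lemma square_free_hist_Cons:
  "square_free_hist (x # r) \<longleftrightarrow> (\<forall>p\<ge>2. match_len (x # r) p < p) \<and> square_free_hist r"
proof
  assume "square_free_hist (x # r)"
  then have *: "match_len (drop i (x # r)) p < p" if "2 \<le> p" for i p
    using that by (simp add: square_free_hist_def)
  show "(\<forall>p\<ge>2. match_len (x # r) p < p) \<and> square_free_hist r"
    using *[of _ 0] *[of _ "Suc _"] by (auto simp: square_free_hist_def)
next
  assume a: "(\<forall>p\<ge>2. match_len (x # r) p < p) \<and> square_free_hist r"
  show "square_free_hist (x # r)"
    unfolding square_free_hist_def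
  proof (intro allI impI)
    fix i p :: nat assume "2 \<le> p"
    with a show "match_len (drop i (x # r)) p < p"
      by (cases i) (auto simp: square_free_hist_def)
  qed
qed

lemma square_free_hist_no_long_square:
  assumes "square_free_hist (rev w @ r)"
  shows "\<not> has_long_square w"
proof
  assume "has_long_square w"
  then obtain xs u ys where w: "w = xs @ (u @ u) @ ys" and u: "2 \<le> length u"
    by (auto simp: has_long_square_def square_of_period_def sublist_def)
  define v where "v = rev u @ rev u @ rev xs @ r"
  have "rev w @ r = rev ys @ v" by (simp add: w v_def)
  moreover have "length u \<le> match_len v (length u)"
    unfolding match_len_ge_iff by (auto simp: v_def nth_append)
  ultimately have "\<not> match_len (drop (length ys) (rev w @ r)) (length u) < length u" by simp
  with assms u show False by (auto simp: square_free_hist_def)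
qed

text \<open>A square completed by \<open>a\<close> or \<open>b\<close> needs a match of length at
  least \<open>p - 2\<close> before Ann's move, prolonged by \<open>a\<close>.\<close>

lemma square_free_hist_step:
  assumes sf: "square_free_hist r" and nb: "\<not> blocked r a"
    and big: "\<And>p. 6 \<le> p \<Longrightarrow> p \<le> length r \<Longrightarrow> p \<le> match_len r p + 2 \<Longrightarrow> r ! (p - 1) \<noteq> a"
  shows "square_free_hist (a # r)" "square_free_hist (b # a # r)"
proof -
  have no: "\<not> (p \<le> length r \<and> p \<le> match_len r p + 2 \<and> r ! (p - 1) = a)" if "2 \<le> p" for p
    using nb big[of p] that by (cases "p \<le> 5") (auto simp: blocked_def)
  have 1: "match_len (a # r) p < p" if "2 \<le> p" for p
    using no[OF that] that by (auto simp: match_len_Cons)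
  have 2: "match_len (b # a # r) p < p" if "2 \<le> p" for p
    using no[OF that] match_len_Cons_Cons[of b a r p] that by fastforce
  show "square_free_hist (a # r)" "square_free_hist (b # a # r)"
    using 1 2 sf by (auto simp: square_free_hist_Cons)
qed

section \<open>The potential\<close>

text \<open>The periods that still have to be feared. For odd periods a match of length 2 is ignored: Ann then has
  one more chance to break it, and the remaining periods are further apart.\<close>

definition alive :: "'a list \<Rightarrow> nat set" where
  "alive r = {p \<in> {6..length r}. \<not> blocked r (r ! (p - 1)) \<and> 2 + p mod 2 \<le> match_len r p}"

lemma finite_alive [simp]: "finite (alive r)"
  by (simp add: alive_def)

text \<open>The latest letters recur at \<open>p\<close> and at \<open>q\<close>, so near
  \<open>p\<close> the history repeats with period \<open>q - p\<close>; a short period contradicts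
  legality or liveness.\<close>

lemma alive_gap:
  assumes t: "legal t" and p: "p \<in> alive t" and q: "q \<in> alive t" and "p < q"
  shows "p + (if even p then 3 else 5) \<le> q"
proof -
  have m: "i + q < length t" "t ! (i + p) = t ! (i + q)" "t ! i = t ! (i + p)" if "i < 2" for i
    using p q that match_len_nth[of i t p] match_len_nth[of i t q] by (auto simp: alive_def)
  have m3: "i + q < length t" "t ! (i + p) = t ! (i + q)" if "i < 3" "odd p" "odd q" for i
    using p q that match_len_nth[of i t p] match_len_nth[of i t q]
    by (auto simp: alive_def odd_iff_mod_2_eq_one)
  have "q \<noteq> p + 1"
  proof
    \<comment> \<open>The letter predicted by \<open>q\<close> equals \<open>t ! 1\<close>, which
      period 2 blocks.\<close>
    assume q1: "q = p + 1"
    have "t ! (q - 1) = t ! 1" using m(3)[of 0] m(2)[of 0] m(3)[of 1] q1 by simp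
    moreover have "2 \<le> length t" using m(1)[of 1] by simp
    ultimately have "blocked t (t ! (q - 1))"
      unfolding blocked_def by (intro bexI[of _ 2]) auto
    with q show False by (simp add: alive_def)
  qed
  moreover have "q \<noteq> p + 2"
  proof
    assume q2: "q = p + 2"
    \<comment> \<open>Period 2 needs a single coincidence, so whichever of \<open>p\<close> and
      \<open>p + 1\<close> is odd will do.\<close>
    define j where "j = (if odd p then p else p + 1)"
    show False
      by (rule legal_no_repetition[OF t, of j 2])
        (use m(1,2)[of 0] m(1,2)[of 1] q2 in \<open>auto simp: j_def\<close>)
  qed
  moreover have "q \<noteq> p + 3" if "odd p"
  proof
    assume q3: "q = p + 3"
    have "j + i + 3 < length t \<and> t ! (j + i) = t ! (j + i + 3)" if "i < 3 - 1" "j = p" for i j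
      using m(1,2)[of i] q3 that by (simp add: add_ac)
    then show False using legal_no_repetition[OF t \<open>odd p\<close>, of 3] by simp
  qed
  moreover have "q \<noteq> p + 4" if "odd p"
  proof
    assume q4: "q = p + 4"
    have "j + i + 4 < length t \<and> t ! (j + i) = t ! (j + i + 4)" if "i < 4 - 1" "j = p" for i j
      using m3[of i] q4 that \<open>odd p\<close> by (simp add: add_ac)
    then show False using legal_no_repetition[OF t \<open>odd p\<close>, of 4] by simp
  qed
  ultimately show ?thesis using \<open>p < q\<close> by (cases "even p") (simp; linarith)+
qed

text \<open>The first exponent is the number of letters of Ann in the current match, the second one the number that
  leads to a square. The weight solves \<open>x' = 3/2 x + charge p\<close>, starting at 0 and reaching 1 at the
  square.\<close>

definition weight :: "nat \<Rightarrow> nat \<Rightarrow> real" where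
  "weight p l = ((3/2) ^ ((if even p then l else l - 1) div 2) - 1) / ((3/2) ^ (p div 2) - 1)"

definition charge :: "nat \<Rightarrow> real" where
  "charge p = 1 / (2 * ((3/2) ^ (p div 2) - 1))"

lemma weight_denom_pos: "2 \<le> p \<Longrightarrow> (3/2 :: real) ^ (p div 2) - 1 > 0"
  by (simp add: one_less_power)

lemma weight_nonneg: "0 \<le> weight p l"
  by (simp add: weight_def one_le_power)

lemma weight_eq_0: "l < 2 + p mod 2 \<Longrightarrow> weight p l = 0"
  by (cases "even p") (auto simp: weight_def odd_iff_mod_2_eq_one)

lemma weight_add_2:
  assumes "p mod 2 \<le> l" "2 \<le> p"
  shows "weight p (l + 2) = 3/2 * weight p l + charge p"
proof -
  have *: "(if even p then l + 2 else l + 2 - 1) div 2 = Suc ((if even p then l else l - 1) div 2)"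
    using assms by (cases "even p") (auto simp: odd_iff_mod_2_eq_one)
  have "(3/2 * x - 1) / d = 3/2 * ((x - 1) / d) + 1 / (2 * d)" if "d > 0" for x d :: real
    using that by (simp add: field_simps)
  from this[OF weight_denom_pos[OF assms(2)]] show ?thesis
    unfolding weight_def charge_def * power_Suc .
qed

text \<open>The right side is \<open>weight p (l + 2)\<close>, whose numerator has an exponent no
  smaller than that of the denominator.\<close>

lemma weight_last:
  assumes "p \<le> l + 2" "2 \<le> p"
  shows "1 \<le> 3/2 * weight p l + charge p"
proof (cases "p mod 2 \<le> l")
  case True
  have "p div 2 \<le> (if even p then l + 2 else l + 2 - 1) div 2"
    using assms by (cases "even p") (auto elim!: evenE oddE)
  then have "(3/2 :: real) ^ (p div 2) \<le> (3/2) ^ ((if even p then l + 2 else l + 2 - 1) div 2)"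
    by (intro power_increasing) auto
  then have "1 \<le> weight p (l + 2)"
    unfolding weight_def using weight_denom_pos[OF assms(2)] by (subst le_divide_eq_1_pos) auto
  with weight_add_2[OF True assms(2)] show ?thesis by simp
next
  case False
  then have "l = 0" "p = 2 \<or> p = 3" using assms by (auto simp: not_le)
  then show ?thesis by (auto simp: weight_def charge_def)
qed

text \<open>An upper bound for the total charge of a set of periods \<open>\<ge> p\<close> with the gaps of
  \<open>alive_gap\<close>: from period 14 on a geometric majorant, below it the values (rounded up) of
  the recursion in \<open>charge_bound_step\<close>.\<close>

definition charge_bound :: "nat \<Rightarrow> real" where
  "charge_bound p = (if p < 14 then [3990, 3090, 2420, 1880, 1530, 1189, 984, 769] ! (p - 6) / 10000
     else (if even p then 11035 else 8582) / 10000 * (2/3) ^ (p div 2))"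

text \<open>\<open>y / (2 * (y - 1))\<close> decreases for \<open>y > 1\<close>, and at
  \<open>y = (3/2) ^ 7\<close> it is just below 0.5311.\<close>

lemma charge_large:
  assumes "14 \<le> p"
  shows "charge p \<le> 5311 / 10000 * (2/3) ^ (p div 2)"
proof -
  define y :: real where "y = (3/2) ^ (p div 2)"
  have "(3/2) ^ 7 \<le> y"
    unfolding y_def using assms by (intro power_increasing) auto
  then have "2187 / 128 \<le> y" by (simp add: power_numeral_even power_numeral_odd)
  then have "1 / (2 * (y - 1)) \<le> 5311 / 10000 * (1 / y)"
    by (simp add: divide_simps)
  also have "1 / y = (2/3) ^ (p div 2)"
    by (simp add: y_def power_divide)
  finally show ?thesis by (simp add: charge_def y_def)
qed

lemma less_14_cases:
  assumes "6 \<le> (p :: nat)" "p < 14"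
  shows "p = 6 \<or> p = 7 \<or> p = 8 \<or> p = 9 \<or> p = 10 \<or> p = 11 \<or> p = 12 \<or> p = 13"
  using assms by presburger

lemma charge_bound_step:
  assumes "6 \<le> p"
  shows "charge p + charge_bound (p + (if even p then 3 else 5)) \<le> charge_bound p"
proof (cases "p < 14")
  case True
  with less_14_cases[OF assms this] show ?thesis
    by (auto simp: charge_def charge_bound_def power_numeral_even power_numeral_odd)
next
  case False
  define x :: real where "x = (2/3) ^ (p div 2)"
  have x: "0 \<le> x" "charge p \<le> 5311 / 10000 * x"
    using charge_large[of p] False by (simp_all add: x_def)
  \<comment> \<open>The coefficients slightly exceed the solution of
    \<open>A = 0.5311 + 2/3 * B\<close> (even \<open>p\<close>) and
    \<open>B = 0.5311 + 8/27 * A\<close> (odd \<open>p\<close>).\<close>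
  show ?thesis
  proof (cases "even p")
    case True
    then have "(p + 3) div 2 = Suc (p div 2)" by (auto elim!: evenE)
    with True False have "charge_bound (p + (if even p then 3 else 5)) = 8582 / 10000 * (2/3 * x)"
      "charge_bound p = 11035 / 10000 * x"
      by (simp_all add: charge_bound_def x_def)
    with x show ?thesis by linarith
  next
    case odd: False
    then have "(p + 5) div 2 = p div 2 + 3" by (auto elim!: oddE)
    with odd False have "charge_bound (p + (if even p then 3 else 5)) = 11035 / 10000 * (8/27 * x)"
      "charge_bound p = 8582 / 10000 * x"
      by (simp_all add: charge_bound_def x_def power_add power_numeral_odd power_numeral_even)
    with x show ?thesis by linarith
  qed
qed

lemma charge_bound_Suc:
  assumes "6 \<le> p"
  shows "charge_bound (Suc p) \<le> charge_bound p"
proof (cases "p < 14")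
  case True
  with less_14_cases[OF assms this] show ?thesis
    by (auto simp: charge_bound_def power_numeral_even power_numeral_odd)
next
  case False
  with zero_le_power[of "2/3 :: real" "p div 2"] show ?thesis
    by (cases "even p") (auto simp: charge_bound_def)
qed

lemma charge_bound_antimono:
  assumes "6 \<le> p" "p \<le> q"
  shows "charge_bound q \<le> charge_bound p"
  using assms(2)
proof (induction q rule: dec_induct)
  case (step n)
  with charge_bound_Suc[of n] assms(1) show ?case by simp
qed simp

lemma charge_bound_nonneg: "6 \<le> p \<Longrightarrow> 0 \<le> charge_bound p"
  using less_14_cases[of p] by (cases "p < 14") (auto simp: charge_bound_def)

text \<open>Split off the least period: the others lie beyond its gap, and
  \<open>charge_bound_step\<close> absorbs its charge.\<close>

lemma sum_charge_le:
  assumes "finite X" "6 \<le> m" "\<And>p. p \<in> X \<Longrightarrow> m \<le> p"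
    and "\<And>p q. p \<in> X \<Longrightarrow> q \<in> X \<Longrightarrow> p < q \<Longrightarrow> p + (if even p then 3 else 5) \<le> q"
  shows "sum charge X \<le> charge_bound m"
  using assms
proof (induction "card X" arbitrary: X m)
  case 0
  then show ?case by (simp add: charge_bound_nonneg)
next
  case (Suc n)
  define p where "p = Min X"
  have "X \<noteq> {}" using Suc.hyps(2) by auto
  then have p: "p \<in> X" "m \<le> p" using Suc.prems by (auto simp: p_def)
  have less: "p < q" if "q \<in> X - {p}" for q
    using that Suc.prems(1) by (auto simp: p_def order.strict_iff_order)
  have "sum charge (X - {p}) \<le> charge_bound (p + (if even p then 3 else 5))"
  proof (rule Suc.hyps(1))
    show "n = card (X - {p})" using Suc.hyps(2) Suc.prems(1) p(1) by simp
    show "6 \<le> p + (if even p then 3 else 5)" using Suc.prems(2) p(2) by simp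
    show "p + (if even p then 3 else 5) \<le> q" if "q \<in> X - {p}" for q
      using Suc.prems(4)[OF p(1) _ less[OF that]] that by simp
    show "q + (if even q then 3 else 5) \<le> q'" if "q \<in> X - {p}" "q' \<in> X - {p}" "q < q'" for q q'
      using Suc.prems(4)[of q q'] that by simp
  qed (use Suc.prems(1) in simp)
  then have "sum charge X \<le> charge p + charge_bound (p + (if even p then 3 else 5))"
    using Suc.prems(1) p(1) by (simp add: sum.remove)
  also have "\<dots> \<le> charge_bound p" using charge_bound_step Suc.prems(2) p(2) by simp
  also have "\<dots> \<le> charge_bound m" using charge_bound_antimono Suc.prems(2) p(2) by simp
  finally show ?case .
qed

definition potential :: "'a list \<Rightarrow> real" where
  "potential r = (\<Sum>p\<in>alive r. weight p (match_len r p))"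

lemma potential_step:
  assumes nb: "\<not> blocked r a"
  shows "potential (b # a # r)
    \<le> 3/2 * (\<Sum>p | p \<in> alive r \<and> r ! (p - 1) = a. weight p (match_len r p)) + sum charge (alive (b # a # r))"
proof -
  define t where "t = b # a # r"
  have t: "p \<le> length r" "r ! (p - 1) = a" "match_len t p = match_len r p + 2" "p mod 2 \<le> match_len r p"
    "6 \<le> p" if "p \<in> alive t" for p
    using match_len_Cons_Cons[of b a r p] that by (auto simp: alive_def t_def)
  have "potential t = (\<Sum>p\<in>alive t. 3/2 * weight p (match_len r p) + charge p)"
    unfolding potential_def
  proof (rule sum.cong)
    fix p assume p: "p \<in> alive t"
    then show "weight p (match_len t p) = 3/2 * weight p (match_len r p) + charge p"
      using weight_add_2[OF t(4)[OF p]] t(3,5)[OF p] by simp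
  qed simp
  also have "\<dots> = 3/2 * (\<Sum>p\<in>alive t. weight p (match_len r p)) + sum charge (alive t)"
    by (simp add: sum.distrib sum_distrib_left)
  also have "(\<Sum>p\<in>alive t. weight p (match_len r p))
      = (\<Sum>p\<in>{p\<in>alive t. p \<in> alive r}. weight p (match_len r p))"
  \<comment> \<open>A newly alive period predicted the unblocked \<open>a\<close>, so only a match
    too short to have weight kept it from being alive before.\<close>
  proof (rule sum.mono_neutral_right)
    show "\<forall>p\<in>alive t - {p \<in> alive t. p \<in> alive r}. weight p (match_len r p) = 0"
      using t nb by (auto simp: alive_def[of r] intro!: weight_eq_0)
  qed auto
  also have "\<dots> \<le> (\<Sum>p | p \<in> alive r \<and> r ! (p - 1) = a. weight p (match_len r p))"
    by (rule sum_mono2) (use t in \<open>auto simp: weight_nonneg\<close>)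
  finally show ?thesis by (simp add: t_def)
qed

section \<open>The finite part\<close>

datatype letter = La | Lb | Lc | Ld

lemma UNIV_letter: "UNIV = {La, Lb, Lc, Ld}"
  by (auto intro: letter.exhaust)

instance letter :: finite
  by standard (simp add: UNIV_letter)

definition letters :: "letter list" where
  "letters = [La, Lb, Lc, Ld]"

fun relabel :: "('a \<times> letter) list \<Rightarrow> letter list \<Rightarrow> 'a list \<Rightarrow> letter list" where
  "relabel m fr [] = []"
| "relabel m fr (x # xs) = (case map_of m x of Some y \<Rightarrow> y # relabel m fr xs
     | None \<Rightarrow> hd fr # relabel ((x, hd fr) # m) (tl fr) xs)"

text \<open>The argument is the recent part of a history, its letters renamed in order of appearance. The table
  was found by computer: it is a slightly coarsened version of the greatest solution \<open>\<le> 1000\<close> of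
  the inequality in \<open>expanding\<close>.\<close>

definition canonical_value :: "letter list \<Rightarrow> int" where
  "canonical_value s = (case s of La # Lb # Lc # La # La # Lb # Ld # La # _ \<Rightarrow> 370
     | La # Lb # Lc # La # La # Lb # Lb # Ld # _ \<Rightarrow> 410
     | La # Lb # Lc # La # La # Lb # La # _ \<Rightarrow> 450
     | La # Lb # Lc # La # La # Lb # Lb # La # _ \<Rightarrow> 450
     | La # Lb # Lc # La # La # Lb # Lb # Lc # _ \<Rightarrow> 450
     | La # Lb # Lc # La # La # Lb # Lc # _ \<Rightarrow> 450
     | La # Lb # Lc # La # La # Lb # Ld # Lc # _ \<Rightarrow> 450
     | La # Lb # Lc # La # La # Lb # Ld # Ld # _ \<Rightarrow> 450
     | La # Lb # Lb # Lc # Ld # La # Lb # Lb # _ \<Rightarrow> 570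
     | La # Lb # Lb # Lc # La # La # Lb # Lb # _ \<Rightarrow> 600
     | La # La # Lb # Lb # La # La # _ \<Rightarrow> 700
     | La # La # Lb # Lb # Lc # La # _ \<Rightarrow> 700
     | La # La # Lb # Lc # Lb # La # _ \<Rightarrow> 700
     | La # La # Lb # Lc # Ld # La # _ \<Rightarrow> 700
     | La # Lb # Lc # Ld # Lc # La # Lb # _ \<Rightarrow> 700
     | La # La # Lb # Lc # La # La # _ \<Rightarrow> 800
     | La # La # Lb # Lc # Lc # La # _ \<Rightarrow> 800
     | La # Lb # Lc # Lc # Lc # _ \<Rightarrow> 800
     | La # Lb # Lc # Lc # Ld # La # Lb # _ \<Rightarrow> 800
     | La # Lb # Lc # Ld # La # La # _ \<Rightarrow> 800
     | La # Lb # La # Lc # La # Lb # _ \<Rightarrow> 810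
     | La # Lb # Lc # La # Ld # Ld # _ \<Rightarrow> 810
     | La # Lb # Lc # Lc # La # _ \<Rightarrow> 810
     | La # La # Lb # Lb # Lb # _ \<Rightarrow> 820
     | La # Lb # La # La # _ \<Rightarrow> 820
     | La # Lb # Lc # La # Ld # Lb # _ \<Rightarrow> 830
     | La # Lb # Lc # La # Ld # Lc # La # La # _ \<Rightarrow> 830
     | La # Lb # Lc # La # Lc # Ld # _ \<Rightarrow> 840
     | La # Lb # Lb # Lc # Lc # La # Lb # Lb # _ \<Rightarrow> 850
     | La # Lb # Lc # La # Lb # Lb # _ \<Rightarrow> 850
     | La # Lb # Lc # Ld # Ld # La # Lb # Lc # _ \<Rightarrow> 850
     | La # Lb # Lb # Lc # La # Lb # Ld # _ \<Rightarrow> 870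
     | La # Lb # Lc # La # La # Ld # _ \<Rightarrow> 870
     | La # Lb # Lc # La # Lc # Lb # _ \<Rightarrow> 880
     | La # Lb # Lc # La # Lc # Lc # _ \<Rightarrow> 880
     | La # Lb # Lc # La # Ld # Lc # Lb # _ \<Rightarrow> 880
     | La # Lb # Lc # La # Ld # Lc # Lc # _ \<Rightarrow> 880
     | La # Lb # Lb # La # La # Lb # _ \<Rightarrow> 900
     | La # Lb # Lb # Lc # La # Lb # La # _ \<Rightarrow> 910
     | La # Lb # Lc # La # Ld # Lc # La # Lb # _ \<Rightarrow> 910
     | La # Lb # Lc # La # Ld # Lc # Ld # _ \<Rightarrow> 910
     | La # Lb # Lc # Ld # La # Lb # _ \<Rightarrow> 910
     | La # Lb # Lb # Lc # Lb # _ \<Rightarrow> 930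
     | La # Lb # Lc # La # La # Lc # _ \<Rightarrow> 930
     | La # Lb # Lc # La # Lb # Ld # _ \<Rightarrow> 930
     | La # Lb # Lb # Lc # La # Lb # Lb # _ \<Rightarrow> 950
     | La # Lb # Lb # Lc # La # Lb # Lc # _ \<Rightarrow> 970
     | La # Lb # Lb # Lc # Ld # La # Lb # Lc # _ \<Rightarrow> 970
     | La # Lb # Lb # Lc # La # La # Lb # Lc # _ \<Rightarrow> 990
     | La # Lb # Lb # Lc # La # La # Lb # Ld # _ \<Rightarrow> 990
     | La # Lb # Lb # Lc # Lc # La # Lb # Lc # _ \<Rightarrow> 990
     | La # Lb # Lb # Lc # Lc # La # Lb # Ld # _ \<Rightarrow> 990
     | La # Lb # Lb # Lc # Ld # La # Lb # Ld # _ \<Rightarrow> 990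
     | _ \<Rightarrow> 1000)"

definition word_value :: "letter list \<Rightarrow> int" where
  "word_value s = canonical_value (relabel [] letters s)"

text \<open>The next three functions see only the last eight letters. The numbers in \<open>charge8\<close>
  are \<open>1000 * charge_bound m\<close> for \<open>m = 6, 7, 8, 9\<close>, where \<open>m\<close> is the least
  period that can be alive after the moves \<open>a\<close> of Ann and \<open>b\<close> of Ben.\<close>

fun blocked8 :: "'a list \<Rightarrow> 'a \<Rightarrow> bool" where
  "blocked8 [x0,x1,x2,x3,x4,x5,x6,x7] a \<longleftrightarrow> a = x1 \<or> a = x2 \<and> x0 = x3
     \<or> a = x3 \<and> x0 = x4 \<and> x1 = x5 \<or> a = x4 \<and> x0 = x5 \<and> x1 = x6 \<and> x2 = x7"
| "blocked8 _ _ \<longleftrightarrow> False"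

fun charge8 :: "'a list \<Rightarrow> 'a \<Rightarrow> 'a \<Rightarrow> int" where
  "charge8 [x0,x1,x2,x3,x4,x5,x6,x7] a b =
     (if x5 = a \<and> x4 = b \<and> (\<not> blocked8 [b,a,x0,x1,x2,x3,x4,x5] x3 \<or> x0 = x6 \<and> x1 = x7) then 399
      else if x6 = a \<and> x5 = b \<and> x0 = x7 then 309
      else if x7 = a \<and> x6 = b then 242 else 188)"
| "charge8 _ _ _ = 0"

fun legal8 :: "'a list \<Rightarrow> bool" where
  "legal8 [x0,x1,x2,x3,x4,x5,x6,x7] \<longleftrightarrow> x1 \<noteq> x3 \<and> x3 \<noteq> x5 \<and> x5 \<noteq> x7 \<and> (x2 = x5 \<longrightarrow> x1 \<noteq> x4)
     \<and> (x4 = x7 \<longrightarrow> x3 \<noteq> x6) \<and> (x2 = x6 \<and> x3 = x7 \<longrightarrow> x1 \<noteq> x5)"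
| "legal8 _ \<longleftrightarrow> False"

definition gain :: "letter list \<Rightarrow> letter \<Rightarrow> letter \<Rightarrow> int" where
  "gain s a b = word_value (b # a # take 6 s) - charge8 s a b"

definition least_gain :: "letter list \<Rightarrow> letter \<Rightarrow> int" where
  "least_gain s a = min (min (gain s a La) (gain s a Lb)) (min (gain s a Lc) (gain s a Ld))"

definition free_gain :: "letter list \<Rightarrow> letter \<Rightarrow> int" where
  "free_gain s a = (if blocked8 s a then 0 else least_gain s a)"

text \<open>The factor 3/2 between value and total gain is the growth factor of inherited
  weights.\<close>

definition expanding :: "letter list \<Rightarrow> bool" where
  "expanding s \<longleftrightarrow> legal8 s \<longrightarrow>
     3 * word_value s \<le> 2 * (free_gain s La + free_gain s Lb + free_gain s Lc + free_gain s Ld)"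

text \<open>The property is tested only on words whose letters appear in alphabetical order; invariance under
  permutations of the alphabet gives the rest.\<close>

fun all_canonical :: "nat \<Rightarrow> (letter list \<Rightarrow> bool) \<Rightarrow> letter list \<Rightarrow> letter list \<Rightarrow> letter list \<Rightarrow> bool" where
  "all_canonical 0 P used fresh xs \<longleftrightarrow> P xs"
| "all_canonical (Suc n) P used fresh xs \<longleftrightarrow>
     list_all (\<lambda>u. all_canonical n P used fresh (xs @ [u])) used \<and>
     (case fresh of [] \<Rightarrow> True | f # fs \<Rightarrow> all_canonical n P (used @ [f]) fs (xs @ [f]))"

lemma all_canonicalD:
  assumes inv: "\<And>\<pi> s. bij \<pi> \<Longrightarrow> P (map \<pi> s) \<longleftrightarrow> P s"
  shows "all_canonical n P used fresh xs \<Longrightarrow> set xs \<subseteq> set used \<Longrightarrow> set used \<union> set fresh = UNIV \<Longrightarrow>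
    distinct (used @ fresh) \<Longrightarrow> length ys = n \<Longrightarrow> P (xs @ ys)"
proof (induction n arbitrary: used fresh xs ys)
  case (Suc n)
  from Suc.prems(5) obtain y zs where ys: "ys = y # zs" "length zs = n" by (cases ys) auto
  show ?case
  proof (cases "y \<in> set used")
    case True
    with Suc.prems(1) have "all_canonical n P used fresh (xs @ [y])" by (simp add: list_all_iff)
    from Suc.IH[OF this _ Suc.prems(3,4) ys(2)] True Suc.prems(2) show ?thesis by (simp add: ys(1))
  next
    case False
    with Suc.prems(3) obtain f fs where fresh: "fresh = f # fs" by (cases fresh) auto
    define \<pi> where "\<pi> = transpose y f"
    have "P ((xs @ [f]) @ map \<pi> zs)"
    proof (rule Suc.IH)
      show "all_canonical n P (used @ [f]) fs (xs @ [f])" using Suc.prems(1) fresh by simp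
    qed (use Suc.prems fresh ys in auto)
    moreover have "map \<pi> (xs @ y # zs) = (xs @ [f]) @ map \<pi> zs"
    proof -
      have "\<pi> x = x" if "x \<in> set xs" for x
        using that False Suc.prems(2,4) fresh by (auto simp: \<pi>_def transpose_def)
      then have "map \<pi> xs = xs" by (simp add: map_idI)
      then show ?thesis by (simp add: \<pi>_def)
    qed
    ultimately have "P (map \<pi> (xs @ y # zs))" by (simp only:)
    moreover have "bij \<pi>" by (simp add: \<pi>_def)
    ultimately show ?thesis using inv ys(1) by blast
  qed
qed simp

section \<open>Invariance under renaming of letters\<close>

lemma relabel_map:
  assumes "inj f"
  shows "relabel (map (apfst f) m) fr (map f xs) = relabel m fr xs"
proof (induction xs arbitrary: m fr)
  case (Cons x xs)
  have "map_of (map (apfst f) m) (f x) = map_of m x"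
    by (induction m) (use assms in \<open>auto simp: inj_eq\<close>)
  then show ?case
    using Cons.IH[of m fr] Cons.IH[of "(x, hd fr) # m" "tl fr"]
    by (cases "map_of m x") simp_all
qed simp

lemma word_value_map: "inj f \<Longrightarrow> word_value (map f s) = word_value s"
  using relabel_map[of f "[]" letters s] by (simp add: word_value_def)

lemma blocked8_map: "inj f \<Longrightarrow> blocked8 (map f s) (f a) = blocked8 s a"
  by (cases "(s, a)" rule: blocked8.cases) (simp_all add: inj_eq)

lemma charge8_map: "inj f \<Longrightarrow> charge8 (map f s) (f a) (f b) = charge8 s a b"
  by (cases "(s, a, b)" rule: charge8.cases) (simp_all only: prod.inject list.map charge8.simps blocked8.simps inj_eq)

lemma legal8_map: "inj f \<Longrightarrow> legal8 (map f s) = legal8 s"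
  by (cases s rule: legal8.cases) (simp_all only: list.map legal8.simps inj_eq)

lemma gain_map:
  assumes "inj f"
  shows "gain (map f s) (f a) (f b) = gain s a b"
  using word_value_map[OF assms, of "b # a # take 6 s"]
  by (simp add: gain_def charge8_map[OF assms] take_map)

lemma least_gain_eq: "least_gain s a = Min (gain s a ` UNIV)"
  by (simp add: least_gain_def UNIV_letter min.assoc min.commute min.left_commute)

lemma sum_UNIV_letter: "sum g UNIV = g La + g Lb + g Lc + g Ld" for g :: "letter \<Rightarrow> 'b :: comm_monoid_add"
  by (simp add: UNIV_letter add.assoc)

text \<open>Renaming permutes Ben's replies inside the minimum and Ann's moves inside the
  sum.\<close>

lemma expanding_map:
  assumes "bij \<pi>"
  shows "expanding (map \<pi> s) \<longleftrightarrow> expanding s"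
proof -
  from assms have inj: "inj \<pi>" and surj: "surj \<pi>" by (auto simp: bij_def)
  have "least_gain (map \<pi> s) (\<pi> a) = least_gain s a" for a
  proof -
    have "gain (map \<pi> s) (\<pi> a) ` UNIV = gain (map \<pi> s) (\<pi> a) ` range \<pi>" by (simp add: surj)
    also have "\<dots> = gain s a ` UNIV" by (simp add: image_image gain_map[OF inj])
    finally show ?thesis by (simp add: least_gain_eq)
  qed
  then have "free_gain (map \<pi> s) (\<pi> a) = free_gain s a" for a
    by (simp add: free_gain_def blocked8_map[OF inj])
  then have "sum (free_gain (map \<pi> s)) UNIV = sum (free_gain s) UNIV"
    using sum.reindex_bij_betw[OF assms, of "free_gain (map \<pi> s)"] by simp
  then show ?thesis
    by (simp add: expanding_def legal8_map[OF inj] word_value_map[OF inj] sum_UNIV_letter)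
qed

text \<open>Evaluation visits 2795 words in place of all \<open>4 ^ 8\<close>.\<close>

lemma all_canonical_expanding: "all_canonical 8 expanding [] letters []"
  by code_simp

lemma expanding: "length s = 8 \<Longrightarrow> expanding s"
  using all_canonicalD[of expanding 8 "[]" letters "[]" s] expanding_map all_canonical_expanding
  by (simp add: letters_def UNIV_letter)

section \<open>The strategy\<close>

lemma length_ge_8_cases:
  assumes "8 \<le> length r"
  obtains x0 x1 x2 x3 x4 x5 x6 x7 r' where "r = x0 # x1 # x2 # x3 # x4 # x5 # x6 # x7 # r'"
  using assms by (auto simp: Suc_le_length_iff numeral_eq_Suc)

text \<open>Period 5 compares positions 0 to 2 with 5 to 7; smaller periods look back less.\<close>

lemma blocked_iff_blocked8:
  "blocked (x0 # x1 # x2 # x3 # x4 # x5 # x6 # x7 # r) a \<longleftrightarrow> blocked8 [x0,x1,x2,x3,x4,x5,x6,x7] a"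
proof -
  have "{2..5 :: nat} = {2, 3, 4, 5}" by auto
  moreover have "2 \<le> match_len r p + 2" "3 \<le> match_len r p + 2 \<longleftrightarrow> 1 \<le> match_len r p"
    "4 \<le> match_len r p + 2 \<longleftrightarrow> 2 \<le> match_len r p" "5 \<le> match_len r p + 2 \<longleftrightarrow> 3 \<le> match_len r p"
    for r :: "'a list" and p by auto
  ultimately show ?thesis
    unfolding blocked_def
    by (simp add: match_len_ge_iff numeral_2_eq_2 numeral_3_eq_3 All_less_Suc2 eval_nat_numeral) auto
qed

lemma legal8_if_legal:
  assumes "legal (x0 # x1 # x2 # x3 # x4 # x5 # x6 # x7 # r)"
  shows "legal8 [x0,x1,x2,x3,x4,x5,x6,x7]"
proof -
  let ?t = "x0 # x1 # x2 # x3 # x4 # x5 # x6 # x7 # r"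
  note no = legal_no_repetition[OF assms]
  have less_3: "i < 3 \<longleftrightarrow> i = 0 \<or> i = 1 \<or> i = 2" for i :: nat by auto
  have "x1 \<noteq> x3" using no[of 1 2] by fastforce
  moreover have "x3 \<noteq> x5" using no[of 3 2] by fastforce
  moreover have "x5 \<noteq> x7" using no[of 5 2] by fastforce
  moreover have "\<not> (x1 = x4 \<and> x2 = x5)"
    by (rule notI, rule no[of 1 3]) (auto simp: less_2_cases_iff)
  moreover have "\<not> (x3 = x6 \<and> x4 = x7)"
    by (rule notI, rule no[of 3 3]) (auto simp: less_2_cases_iff)
  moreover have "\<not> (x1 = x5 \<and> x2 = x6 \<and> x3 = x7)"
    by (rule notI, rule no[of 1 4]) (auto simp: less_3)
  ultimately show ?thesis by auto
qed

lemma nested_if_cases: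
  obtains "(if P then w else if Q then x else if R then y else z) = w"
  | "(if P then w else if Q then x else if R then y else z) = x" "\<not> P"
  | "(if P then w else if Q then x else if R then y else z) = y" "\<not> P" "\<not> Q"
  | "(if P then w else if Q then x else if R then y else z) = z" "\<not> P" "\<not> Q" "\<not> R"
  by (cases P; cases Q; cases R) auto

lemma charge8_cases:
  obtains "charge8 [x0,x1,x2,x3,x4,x5,x6,x7] a b = 399"
  | "charge8 [x0,x1,x2,x3,x4,x5,x6,x7] a b = 309"
    "\<not> (x5 = a \<and> x4 = b \<and> (\<not> blocked8 [b,a,x0,x1,x2,x3,x4,x5] x3 \<or> x0 = x6 \<and> x1 = x7))"
  | "charge8 [x0,x1,x2,x3,x4,x5,x6,x7] a b = 242"
    "\<not> (x5 = a \<and> x4 = b \<and> (\<not> blocked8 [b,a,x0,x1,x2,x3,x4,x5] x3 \<or> x0 = x6 \<and> x1 = x7))"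
    "\<not> (x6 = a \<and> x5 = b \<and> x0 = x7)"
  | "charge8 [x0,x1,x2,x3,x4,x5,x6,x7] a b = 188"
    "\<not> (x5 = a \<and> x4 = b \<and> (\<not> blocked8 [b,a,x0,x1,x2,x3,x4,x5] x3 \<or> x0 = x6 \<and> x1 = x7))"
    "\<not> (x6 = a \<and> x5 = b \<and> x0 = x7)" "\<not> (x7 = a \<and> x6 = b)"
  unfolding charge8.simps by (rule nested_if_cases)

text \<open>Each failed condition of \<open>charge8\<close> excludes 6, 7 or 8 from the alive
  periods, which improves the bound from \<open>sum_charge_le\<close>.\<close>

lemma sum_charge_alive_le:
  assumes "8 \<le> length r" "legal (b # a # r)"
  shows "sum charge (alive (b # a # r)) \<le> real_of_int (charge8 (take 8 r) a b) / 1000"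
proof -
  define t where "t = b # a # r"
  obtain x0 x1 x2 x3 x4 x5 x6 x7 r' where r: "r = x0 # x1 # x2 # x3 # x4 # x5 # x6 # x7 # r'"
    using length_ge_8_cases[OF assms(1)] .
  have m: "r ! (p - 1) = a" "r ! (p - 2) = b" "6 \<le> p" "p mod 2 \<le> match_len r p"
    "\<not> blocked t (t ! (p - 1))" if "p \<in> alive t" for p
    using match_len_Cons_Cons[of b a r p] that by (auto simp: alive_def t_def)
  \<comment> \<open>\<open>x3\<close> is the letter that period 6 predicts after both moves; an
    alive period predicts an unblocked letter.\<close>
  have 6: "x5 = a \<and> x4 = b \<and> \<not> blocked8 [b,a,x0,x1,x2,x3,x4,x5] x3" if "6 \<in> alive t"
    using m[OF that] by (simp add: t_def r blocked_iff_blocked8 del: blocked8.simps)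
  have 7: "x6 = a \<and> x5 = b \<and> x0 = x7" if "7 \<in> alive t"
    using m[OF that] match_len_nth[of 0 r 7] by (simp add: r)
  have 8: "x7 = a \<and> x6 = b" if "8 \<in> alive t"
    using m[OF that] by (simp add: r)
  have bound: "sum charge (alive t) \<le> charge_bound n"
    if "6 \<le> n" "\<And>p. p \<in> alive t \<Longrightarrow> n \<le> p" for n
    using that alive_gap[OF assms(2)] by (intro sum_charge_le) (auto simp: t_def)
  have suc: "Suc n \<le> p" if "n \<le> p" "p \<in> alive t" "n \<notin> alive t" for n p
    using that by (cases "n = p") auto
  have s: "take 8 r = [x0,x1,x2,x3,x4,x5,x6,x7]" by (simp add: r)
  show ?thesis
    unfolding s t_def[symmetric]
  proof (cases rule: charge8_cases[of x0 x1 x2 x3 x4 x5 x6 x7 a b])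
    case 1
    then show "sum charge (alive t) \<le> real_of_int (charge8 [x0,x1,x2,x3,x4,x5,x6,x7] a b) / 1000"
      using bound[of 6] m(3) by (simp add: charge_bound_def del: charge8.simps)
  next
    case 2
    then have "7 \<le> p" if "p \<in> alive t" for p using 6 suc[of 6 p] m(3)[OF that] that by auto
    with 2 show "sum charge (alive t) \<le> real_of_int (charge8 [x0,x1,x2,x3,x4,x5,x6,x7] a b) / 1000"
      using bound[of 7] by (simp add: charge_bound_def del: charge8.simps)
  next
    case 3
    then have "8 \<le> p" if "p \<in> alive t" for p
      using 6 7 suc[of 6 p] suc[of 7 p] m(3)[OF that] that by auto
    with 3 show "sum charge (alive t) \<le> real_of_int (charge8 [x0,x1,x2,x3,x4,x5,x6,x7] a b) / 1000"
      using bound[of 8] by (simp add: charge_bound_def del: charge8.simps)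
  next
    case 4
    then have "9 \<le> p" if "p \<in> alive t" for p
      using 6 7 8 suc[of 6 p] suc[of 7 p] suc[of 8 p] m(3)[OF that] that by auto
    with 4 show "sum charge (alive t) \<le> real_of_int (charge8 [x0,x1,x2,x3,x4,x5,x6,x7] a b) / 1000"
      using bound[of 9] by (simp add: charge_bound_def del: charge8.simps)
  qed
qed

text \<open>Here \<open>p\<close> is about to complete a square and need not be alive after the
  moves; the alternative \<open>x0 = x6 \<and> x1 = x7\<close> in \<open>charge8\<close> covers this
  for period 6.\<close>

lemma charge_le_charge8:
  assumes "8 \<le> length r" "6 \<le> p" "p \<le> length r" "p \<le> match_len r p + 2" "r ! (p - 1) = a"
  shows "charge p \<le> real_of_int (charge8 (take 8 r) a (r ! (p - 2))) / 1000"
proof -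
  obtain x0 x1 x2 x3 x4 x5 x6 x7 r' where r: "r = x0 # x1 # x2 # x3 # x4 # x5 # x6 # x7 # r'"
    using length_ge_8_cases[OF assms(1)] .
  define b where "b = r ! (p - 2)"
  have s: "take 8 r = [x0,x1,x2,x3,x4,x5,x6,x7]" by (simp add: r)
  have m: "r ! i = r ! (i + p)" if "i + 2 < p" for i
    using match_len_nth[of i r p] assms(4) that by simp
  have c: "charge p \<le> charge_bound n" if "6 \<le> n" "n \<le> p" for n
    using charge_bound_step[OF assms(2)] charge_bound_nonneg[of "p + (if even p then 3 else 5)"]
      charge_bound_antimono[OF that] assms(2) by simp
  have 6: "x5 = a \<and> x4 = b \<and> x0 = x6 \<and> x1 = x7" if "p = 6"
    using m[of 0] m[of 1] that assms(5) by (simp add: r b_def)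
  have 7: "x6 = a \<and> x5 = b \<and> x0 = x7" if "p = 7"
    using m[of 0] that assms(5) by (simp add: r b_def)
  have 8: "x7 = a \<and> x6 = b" if "p = 8"
    using that assms(5) by (simp add: r b_def)
  show ?thesis
    unfolding s b_def[symmetric]
  proof (cases rule: charge8_cases[of x0 x1 x2 x3 x4 x5 x6 x7 a b])
    case 1
    then show "charge p \<le> real_of_int (charge8 [x0,x1,x2,x3,x4,x5,x6,x7] a b) / 1000"
      using c[of 6] assms(2) by (simp add: charge_bound_def del: charge8.simps)
  next
    case 2
    then have "7 \<le> p" using 6 assms(2) by (cases "p = 6") auto
    with 2 show "charge p \<le> real_of_int (charge8 [x0,x1,x2,x3,x4,x5,x6,x7] a b) / 1000"
      using c[of 7] by (simp add: charge_bound_def del: charge8.simps)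
  next
    case 3
    then have "8 \<le> p" using 6 7 assms(2) by (cases "p = 6"; cases "p = 7") auto
    with 3 show "charge p \<le> real_of_int (charge8 [x0,x1,x2,x3,x4,x5,x6,x7] a b) / 1000"
      using c[of 8] by (simp add: charge_bound_def del: charge8.simps)
  next
    case 4
    then have "9 \<le> p" using 6 7 8 assms(2) by (cases "p = 6"; cases "p = 7"; cases "p = 8") auto
    with 4 show "charge p \<le> real_of_int (charge8 [x0,x1,x2,x3,x4,x5,x6,x7] a b) / 1000"
      using c[of 9] by (simp add: charge_bound_def del: charge8.simps)
  qed
qed

text \<open>In thousandths, this is the weight of a completed square, so a period at its last chance
  can pay for any value.\<close>

lemma word_value_le: "word_value s \<le> 1000"
  unfolding word_value_def canonical_value_def by (simp split: list.split letter.split)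

definition safe :: "letter list \<Rightarrow> bool" where
  "safe r \<longleftrightarrow> 8 \<le> length r \<and> legal r \<and> square_free_hist r \<and>
     potential r < real_of_int (word_value (take 8 r)) / 1000"

text \<open>If every letter \<open>a\<close> of Ann had a reply \<open>b\<close> leading to an unsafe word, then the value
  of each resulting word would be paid for by the weights of the periods predicting \<open>a\<close> and the new
  charges. Summed over \<open>a\<close> this contradicts \<open>expanding\<close>. If \<open>a\<close> is the last chance of some
  period, that period alone pays, and \<open>b\<close> is taken to be the letter continuing it.\<close>

lemma safe_step:
  assumes "safe r"
  shows "\<exists>a. square_free_hist (a # r) \<and> (\<forall>b. safe (b # a # r))"
proof (rule ccontr)
  assume none: "\<nexists>a. square_free_hist (a # r) \<and> (\<forall>b. safe (b # a # r))"
  have r: "8 \<le> length r" "legal r" "square_free_hist r"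
    "potential r < real_of_int (word_value (take 8 r)) / 1000"
    using assms by (auto simp: safe_def)
  define s where "s = take 8 r"
  have s: "length s = 8" using r(1) by (simp add: s_def)
  obtain x0 x1 x2 x3 x4 x5 x6 x7 r' where xs: "r = x0 # x1 # x2 # x3 # x4 # x5 # x6 # x7 # r'"
    using length_ge_8_cases[OF r(1)] .
  have legal: "legal8 s"
    using legal8_if_legal r(2) by (simp add: s_def xs del: legal8.simps)
  have blocked: "blocked r a \<longleftrightarrow> blocked8 s a" for a
    by (simp add: s_def xs blocked_iff_blocked8 del: blocked8.simps)
  define part where "part a = (\<Sum>p | p \<in> alive r \<and> r ! (p - 1) = a. weight p (match_len r p))" for a
  have part_nonneg: "0 \<le> part a" for a
    unfolding part_def by (intro sum_nonneg weight_nonneg)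
  have part_sum: "sum part UNIV = potential r"
    unfolding part_def potential_def by (subst sum.group) auto
  have "real_of_int (free_gain s a) / 1000 \<le> 3/2 * part a" for a
  proof (cases "blocked r a")
    case True
    then show ?thesis using part_nonneg[of a] by (simp add: free_gain_def blocked)
  next
    case nb: False
    have "\<exists>b. real_of_int (gain s a b) / 1000 \<le> 3/2 * part a"
    proof (cases "\<exists>p. 6 \<le> p \<and> p \<le> length r \<and> p \<le> match_len r p + 2 \<and> r ! (p - 1) = a")
      case True
      then obtain p where p: "6 \<le> p" "p \<le> length r" "p \<le> match_len r p + 2" "r ! (p - 1) = a" by blast
      then have "p \<in> alive r" using nb by (auto simp: alive_def)
      then have "weight p (match_len r p) \<le> part a"
        unfolding part_def using p(4) by (intro member_le_sum) (auto simp: weight_nonneg)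
      moreover have "1 \<le> 3/2 * weight p (match_len r p) + charge p"
        using weight_last p by simp
      moreover note charge_le_charge8[OF r(1) p] word_value_le[of "r ! (p - 2) # a # take 6 s"]
      ultimately have "real_of_int (gain s a (r ! (p - 2))) / 1000 \<le> 3/2 * part a"
        by (simp add: gain_def s_def)
      then show ?thesis by blast
    next
      case big: False
      note sf = square_free_hist_step[OF r(3) nb]
      from none sf(1) big obtain b where "\<not> safe (b # a # r)" by blast
      moreover have t: "legal (b # a # r)" using r(2) nb by (simp add: legal_Cons_Cons)
      moreover have "square_free_hist (b # a # r)" using sf(2) big by blast
      moreover have "take 8 (b # a # r) = b # a # take 6 s" by (simp add: s_def)
      ultimately have "real_of_int (word_value (b # a # take 6 s)) / 1000 \<le> potential (b # a # r)"
        using r(1) by (simp add: safe_def)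
      also have "\<dots> \<le> 3/2 * part a + real_of_int (charge8 s a b) / 1000"
        using potential_step[OF nb, of b] sum_charge_alive_le[OF r(1) t] by (simp add: part_def s_def)
      finally show ?thesis by (intro exI[of _ b]) (simp add: gain_def)
    qed
    then obtain b where "real_of_int (gain s a b) / 1000 \<le> 3/2 * part a" by blast
    moreover have "least_gain s a \<le> gain s a b"
      unfolding least_gain_eq by (intro Min_le) auto
    ultimately show ?thesis using nb by (simp add: free_gain_def blocked)
  qed
  then have "(\<Sum>a\<in>UNIV. real_of_int (free_gain s a) / 1000) \<le> (\<Sum>a\<in>UNIV. 3/2 * part a)"
    by (intro sum_mono)
  also have "\<dots> = 3/2 * potential r"
    by (simp only: sum_distrib_left[symmetric] part_sum)
  finally have "real_of_int (2 * sum (free_gain s) UNIV) / 1000 \<le> 3 * potential r"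
    by (simp add: sum_divide_distrib[symmetric])
  moreover have "3 * word_value s \<le> 2 * sum (free_gain s) UNIV"
    using expanding[OF s] legal by (simp add: expanding_def sum_UNIV_letter)
  ultimately have "real_of_int (3 * word_value s) / 1000 \<le> 3 * potential r"
    by (smt (verit) divide_right_mono of_int_le_iff)
  with r(4) show False by (simp add: s_def)
qed

text \<open>Ann pretends that these letters were played before the game, so that eight letters are always visible.\<close>

definition prehistory :: "letter list" where
  "prehistory = [La, Lb, Lc, Ld, Lc, La, Ld, Lb]"

lemma safe_prehistory: "safe prehistory"
proof -
  have "\<not> (2 \<le> p \<and> p \<le> match_len (drop i prehistory) p)" for i p
  proof
    assume p: "2 \<le> p \<and> p \<le> match_len (drop i prehistory) p"
    then have "p + p \<le> length (drop i prehistory)" "\<forall>j<p. drop i prehistory ! j = drop i prehistory ! (j + p)"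
      unfolding match_len_ge_iff by auto
    \<comment> \<open>Two coincidences of each possible square already suffice to exclude
      it.\<close>
    with p have "p + p + i \<le> 8" "prehistory ! i = prehistory ! (i + p)" "prehistory ! Suc i = prehistory ! (Suc i + p)"
      by (auto simp: prehistory_def add_ac dest: spec[of _ 0] spec[of _ 1])
    moreover from this p have "p \<in> {2, 3, 4}" "i \<in> {0, 1, 2, 3, 4}" by auto
    ultimately show False by (auto simp: prehistory_def)
  qed
  then have "square_free_hist prehistory" unfolding square_free_hist_def by (meson not_le)
  moreover have "legal prehistory"
  proof -
    have "{2..5 :: nat} = {2, 3, 4, 5}" by auto
    moreover have "legal []" by (simp add: legal_def)
    ultimately show ?thesis
      by (simp add: prehistory_def legal_Cons_Cons blocked_def match_len_def)
  qed
  moreover have "alive prehistory = {}"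
  proof -
    have "match_len prehistory p = 0" if "p \<in> {6..length prehistory}" for p
    proof -
      from that have "p = 6 \<or> p = 7 \<or> p = 8" by (auto simp: prehistory_def)
      then show ?thesis by (auto simp: prehistory_def match_len_def)
    qed
    then show ?thesis by (auto simp: alive_def)
  qed
  then have "potential prehistory = 0" by (simp add: potential_def)
  moreover have "word_value (take 8 prehistory) = 1000"
    by (simp add: prehistory_def word_value_def canonical_value_def letters_def)
  ultimately show ?thesis by (simp add: safe_def prehistory_def)
qed

definition ann_choice :: "letter list \<Rightarrow> letter" where
  "ann_choice r = (SOME a. square_free_hist (a # r) \<and> (\<forall>b. safe (b # a # r)))"

lemma ann_choice:
  assumes "safe r"
  shows "square_free_hist (ann_choice r # r)" "safe (b # ann_choice r # r)"
  using someI_ex[OF safe_step[OF assms]] by (auto simp: ann_choice_def)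

lemma has_long_square_map:
  assumes "has_long_square w"
  shows "has_long_square (map f w)"
proof -
  from assms obtain xs u ys where w: "w = xs @ (u @ u) @ ys" and u: "2 \<le> length u"
    by (auto simp: has_long_square_def square_of_period_def sublist_def)
  have "sublist (map f u @ map f u) (map f w)"
    unfolding sublist_def w by (intro exI[of _ "map f xs"] exI[of _ "map f ys"]) simp
  with u show ?thesis
    unfolding has_long_square_def square_of_period_def
    by (intro exI[of _ "map f u @ map f u"] exI[of _ "length u"] conjI exI[of _ "map f u"]) auto
qed

text \<open>Ann uses only four letters and reads any other letter of Ben as one of these: this can only create
  squares.\<close>

theorem theorem1:
  fixes A :: "'a set"
  assumes "finite A" and "card A \<ge> 4"
  shows "\<exists>\<sigma>. ann_winning_strategy A \<sigma>"
proof -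
  have "card (UNIV :: letter set) \<le> card A" using assms(2) by (simp add: UNIV_letter)
  then obtain e :: "letter \<Rightarrow> 'a" where e: "inj e" "range e \<subseteq> A"
    using card_le_inj[of "UNIV :: letter set" A] assms(1) by auto
  define \<phi> where "\<phi> = inv e"
  define hist where "hist w = rev (map \<phi> w) @ prehistory" for w
  define \<sigma> where "\<sigma> w = e (ann_choice (hist w))" for w
  have "safe (hist (play \<sigma> b (2 * m)))" for b m
  proof (induction m)
    case 0
    then show ?case by (simp add: hist_def safe_prehistory)
  next
    case (Suc m)
    from ann_choice(2)[OF this] show ?case by (simp add: hist_def \<sigma>_def \<phi>_def inv_f_f[OF e(1)])
  qed
  then have "square_free_hist (hist (play \<sigma> b n))" for b n
  proof (cases "even n")
    case True
    then show ?thesis using \<open>\<And>b m. safe (hist (play \<sigma> b (2 * m)))\<close> by (auto simp: safe_def elim!: evenE)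
  next
    case False
    then obtain m where n: "n = Suc (2 * m)" by (auto elim!: oddE)
    from ann_choice(1)[OF \<open>\<And>b m. safe (hist (play \<sigma> b (2 * m)))\<close>[of b m]] show ?thesis
      by (simp add: n hist_def \<sigma>_def \<phi>_def inv_f_f[OF e(1)])
  qed
  then have "\<not> has_long_square (play \<sigma> b n)" for b n
    using has_long_square_map[of "play \<sigma> b n" \<phi>] square_free_hist_no_long_square
    by (metis hist_def)
  moreover have "ann_strategy A \<sigma>"
    using e(2) by (auto simp: ann_strategy_def \<sigma>_def)
  ultimately show ?thesis by (auto simp: ann_winning_strategy_def)
qed

end
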